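(* A Banach space $X$ is reflexive if and only if $R(X)=0$.
   Context: Banach spaces are infinite-dimensional, over the real or complex field; $B_X$ denotes the closed unit ball of $X$. A sequence $(y_n)_{n=1}^\infty$ is a convex block subsequence of $(x_n)_{n=1}^\infty$ if there is a strictly increasing sequence of positive integers $(k_n)_{n=1}^\infty$ such that, with $k_0=0$, $y_n\in\operatorname{conv}\{x_i: k_{n-1}+1\leqslant i\leqslant k_n\}$ for every $n\in\mathbb N$. The collection of all convex block subsequences of $(x_n)$ is denoted $\operatorname{cbs}((x_n)_{n=1}^\infty)$. For a bounded sequence $(x_n)_{n=1}^\infty$ in a Banach space set $\operatorname{ca}((x_n)_{n=1}^\infty)=\inf_{n\in\mathbb N}\sup_{k,l\geqslant n}\|x_k-x_l\|$. Define $$R(X)=\sup_{(x_n)_{n=1}^\infty\subseteq B_X}\ \inf_{(z_n)\in\operatorname{cbs}((x_n))}\operatorname{ca}((z_n)_{n=1}^\infty),$$ where the supremum is over all sequences in $B_X$. *)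

theory Defs
  imports "HOL-Analysis.Analysis"
begin

text \<open>
  The distribution has no type class of complex normed spaces. A Banach space over
  \<open>'k\<close> (here \<open>real\<close> or \<open>complex\<close>) is therefore a type of class \<open>banach\<close> together with a scalar
  multiplication by \<open>'k\<close> that restricts to the real one of the class.
\<close>

locale normed_space_over = vector_space sm
  for sm :: "'k::real_normed_field \<Rightarrow> 'a::real_normed_vector \<Rightarrow> 'a" +
  assumes scale_of_real: "sm (of_real r) x = r *\<^sub>R x"
    and norm_scale: "norm (sm c x) = norm c * norm x"

definition infinite_dimensional :: "('k::field \<Rightarrow> 'a::ab_group_add \<Rightarrow> 'a) \<Rightarrow> bool" where
  "infinite_dimensional sm \<longleftrightarrow> \<not> (\<exists>B. finite B \<and> module.span sm B = UNIV)"

text \<open>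
  \<open>bounded_linear\<close> is linearity over the reals; the second conjunct makes it linearity over \<open>'k\<close>.
  The dual norm is \<open>onorm\<close>.
\<close>

definition dual :: "('k::real_normed_field \<Rightarrow> 'a::real_normed_vector \<Rightarrow> 'a) \<Rightarrow> ('a \<Rightarrow> 'k) set" where
  "dual sm = {f. bounded_linear f \<and> (\<forall>c x. f (sm c x) = c * f x)}"

text \<open>
  Bounded \<open>'k\<close>-linear functionals on the dual. The dual is a set rather than a type, so
  extensionality is what makes two functionals agreeing on the dual equal.
\<close>

definition bidual ::
    "('k::real_normed_field \<Rightarrow> 'a::real_normed_vector \<Rightarrow> 'a) \<Rightarrow> (('a \<Rightarrow> 'k) \<Rightarrow> 'k) set" where
  "bidual sm = {\<phi> \<in> extensional (dual sm).
      (\<forall>f\<in>dual sm. \<forall>g\<in>dual sm. \<phi> (\<lambda>x. f x + g x) = \<phi> f + \<phi> g) \<and>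
      (\<forall>c. \<forall>f\<in>dual sm. \<phi> (\<lambda>x. c * f x) = c * \<phi> f) \<and>
      (\<exists>C. \<forall>f\<in>dual sm. norm (\<phi> f) \<le> C * onorm f)}"

definition canonical_embedding ::
    "('k::real_normed_field \<Rightarrow> 'a::real_normed_vector \<Rightarrow> 'a) \<Rightarrow> 'a \<Rightarrow> ('a \<Rightarrow> 'k) \<Rightarrow> 'k" where
  "canonical_embedding sm x = (\<lambda>f\<in>dual sm. f x)"

definition reflexive :: "('k::real_normed_field \<Rightarrow> 'a::real_normed_vector \<Rightarrow> 'a) \<Rightarrow> bool" where
  "reflexive sm \<longleftrightarrow> range (canonical_embedding sm) = bidual sm"

text \<open>
  Sequences are indexed from 0, so the block of indices \<open>k\<^sub>n\<^sub>-\<^sub>1 + 1 \<le> i \<le> k\<^sub>n\<close> of a sequence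
  indexed from 1 becomes \<open>{k n..<k (Suc n)}\<close>.
\<close>

definition cbs :: "(nat \<Rightarrow> 'a::real_vector) \<Rightarrow> (nat \<Rightarrow> 'a) set" where
  "cbs x = {y. \<exists>k::nat \<Rightarrow> nat. strict_mono k \<and> k 0 = 0 \<and>
                (\<forall>n. y n \<in> convex hull (x ` {k n..<k (Suc n)}))}"

text \<open>
  In the next two definitions the suprema and infima are those of the reals, which carry their
  meaning only for nonempty bounded sets; the lemmas below check this.
\<close>

definition ca :: "(nat \<Rightarrow> 'a::real_normed_vector) \<Rightarrow> real" where
  "ca x = (INF n. SUP (k, l)\<in>{n..} \<times> {n..}. norm (x k - x l))"

definition R_const :: "'a::real_normed_vector itself \<Rightarrow> real" where
  "R_const _ = (SUP x\<in>{x :: nat \<Rightarrow> 'a. range x \<subseteq> cball 0 1}. INF z\<in>cbs x. ca z)"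

lemma normed_space_over_scaleR:
  "normed_space_over (scaleR :: real \<Rightarrow> 'a::real_normed_vector \<Rightarrow> 'a)"
  by unfold_locales (auto simp: algebra_simps)

lemma canonical_embedding_in_bidual:
  assumes "normed_space_over sm"
  shows "canonical_embedding sm x \<in> bidual sm"
proof -
  have add: "(\<lambda>x. f x + g x) \<in> dual sm" if "f \<in> dual sm" "g \<in> dual sm" for f g
    using that by (auto simp: dual_def algebra_simps intro: bounded_linear_add)
  have mult: "(\<lambda>x. c * f x) \<in> dual sm" if "f \<in> dual sm" for f c
    using that by (auto simp: dual_def intro: bounded_linear_const_mult)
  have "norm (f x) \<le> norm x * onorm f" if "f \<in> dual sm" for f
    using onorm[of f x] that by (auto simp: dual_def mult.commute)
  then show ?thesis
    using add mult by (auto simp: bidual_def canonical_embedding_def intro!: exI[of _ "norm x"])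
qed

lemma cbs_refl: "x \<in> cbs x"
  by (auto simp: cbs_def strict_mono_def intro!: exI[of _ id])

lemma cbs_cball:
  fixes x :: "nat \<Rightarrow> 'a::real_normed_vector"
  assumes "range x \<subseteq> cball 0 1" "z \<in> cbs x"
  shows "range z \<subseteq> cball 0 1"
proof -
  have "convex hull (x ` A) \<subseteq> cball 0 1" for A
    using assms(1) by (intro hull_minimal) auto
  then show ?thesis using assms(2) by (fastforce simp: cbs_def)
qed

lemma ca_bdd_above:
  fixes x :: "nat \<Rightarrow> 'a::real_normed_vector"
  assumes "bounded (range x)"
  shows "bdd_above ((\<lambda>(k, l). norm (x k - x l)) ` ({n..} \<times> {n..}))"
proof -
  obtain C where "norm (x i) \<le> C" for i using assms by (auto simp: bounded_iff)
  then have "norm (x k - x l) \<le> C + C" for k l by (meson add_mono norm_triangle_le_diff)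
  then show ?thesis by (auto simp: bdd_above_def)
qed

lemma ca_SUP_nonneg:
  fixes x :: "nat \<Rightarrow> 'a::real_normed_vector"
  assumes "bounded (range x)"
  shows "0 \<le> (SUP (k, l)\<in>{n..} \<times> {n..}. norm (x k - x l))"
  using cSUP_upper[OF _ ca_bdd_above[OF assms], of "(n, n)" n] by simp

lemma ca_nonneg:
  fixes x :: "nat \<Rightarrow> 'a::real_normed_vector"
  assumes "bounded (range x)"
  shows "0 \<le> ca x"
  unfolding ca_def by (rule cINF_greatest) (use ca_SUP_nonneg[OF assms] in auto)

lemma ca_le_2:
  fixes x :: "nat \<Rightarrow> 'a::real_normed_vector"
  assumes "range x \<subseteq> cball 0 1"
  shows "ca x \<le> 2"
proof -
  have bd: "bounded (range x)" using assms bounded_cball bounded_subset by blast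
  have *: "norm (x i) \<le> 1" for i
    using assms by (metis mem_cball_0 range_subsetD)
  have "norm (x k - x l) \<le> 2" for k l
    using norm_triangle_ineq4[of "x k" "x l"] *[of k] *[of l] by linarith
  then have "(SUP (k, l)\<in>{0..} \<times> {0..}. norm (x k - x l)) \<le> 2"
    by (intro cSUP_least) auto
  moreover have "ca x \<le> (SUP (k, l)\<in>{0..} \<times> {0..}. norm (x k - x l))"
    unfolding ca_def
    by (rule cINF_lower) (use ca_SUP_nonneg[OF bd] in \<open>auto simp: bdd_below_def\<close>)
  ultimately show ?thesis by linarith
qed

lemma R_const_bounds:
  fixes x :: "nat \<Rightarrow> 'a::real_normed_vector"
  assumes "range x \<subseteq> cball 0 1"
  shows "bdd_below (ca ` cbs x)" "0 \<le> (INF z\<in>cbs x. ca z)" "(INF z\<in>cbs x. ca z) \<le> 2"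
proof -
  have nn: "0 \<le> ca z" if "z \<in> cbs x" for z
    using ca_nonneg cbs_cball[OF assms that] bounded_cball bounded_subset by blast
  then show bdd: "bdd_below (ca ` cbs x)" by (auto simp: bdd_below_def)
  show "0 \<le> (INF z\<in>cbs x. ca z)" by (rule cINF_greatest) (use nn cbs_refl in auto)
  show "(INF z\<in>cbs x. ca z) \<le> 2"
    using cINF_lower[OF bdd cbs_refl] ca_le_2[OF assms] by linarith
qed

end

theory Submission
  imports Defs
begin

text \<open>
  If \<open>X\<close> is reflexive and \<open>x n\<close> lies in the unit ball, a Hahn--Banach functional on \<open>X*\<close> dominated by
  \<open>limsup f (x n)\<close> is evaluation at some \<open>y\<close>, and separation puts \<open>y\<close> into the closed convex hull of
  every tail. Convex blocks close to \<open>y\<close> have small \<open>ca\<close>. Conversely, let \<open>F\<close> in the unit ball of \<open>X**\<close>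
  have distance greater than \<open>d > 0\<close> to \<open>X\<close>. As in James' theorem one chooses alternately a functional \<open>g\<close>
  of norm at most 1 with \<open>g (x i) < F g - d\<close> for the \<open>x i\<close> already chosen, and a next unit ball point
  at which every functional chosen so far exceeds \<open>F g - d / 2\<close>. Both choices come from a minimax
  argument for finitely many functionals. The convex hulls of an initial segment and of the remaining
  tail are then \<open>d / 2\<close> apart, so every convex block subsequence has
  \<open>ca \<ge> d / 2\<close>. The complex case reduces to the real one by taking real parts.
\<close>

section \<open>The Hahn--Banach theorem\<close>

text \<open>Homogeneity is asked only as an inequality for \<open>t > 0\<close>, a form that passes
  to pointwise infima; using it with \<open>inverse t\<close> as well gives equality.\<close>

definition sublinear :: "('v::real_vector \<Rightarrow> real) \<Rightarrow> bool" where
  "sublinear p \<longleftrightarrow> (\<forall>x y. p (x + y) \<le> p x + p y) \<and> (\<forall>t>0. \<forall>x. p (t *\<^sub>R x) \<le> t * p x)"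

lemma sublinear_add: "sublinear p \<Longrightarrow> p (x + y) \<le> p x + p y"
  by (simp add: sublinear_def)

lemma sublinear_scaleR_pos:
  assumes "sublinear p" "t > 0"
  shows "p (t *\<^sub>R x) = t * p x"
proof (rule antisym)
  have "p (inverse t *\<^sub>R t *\<^sub>R x) \<le> inverse t * p (t *\<^sub>R x)"
    using assms positive_imp_inverse_positive[of t] unfolding sublinear_def by blast
  then have "p x \<le> inverse t * p (t *\<^sub>R x)" using assms by simp
  then show "t * p x \<le> p (t *\<^sub>R x)" using assms by (simp add: field_simps)
qed (use assms in \<open>auto simp: sublinear_def\<close>)

lemma sublinear_0: "sublinear p \<Longrightarrow> p 0 = 0"
  using sublinear_scaleR_pos[of p 2 0] by simp

lemma sublinear_scaleR_nonneg: "sublinear p \<Longrightarrow> t \<ge> 0 \<Longrightarrow> p (t *\<^sub>R x) = t * p x"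
  by (cases "t = 0") (auto simp: sublinear_0 sublinear_scaleR_pos)

lemma sublinear_minus_le: "sublinear p \<Longrightarrow> - p (- x) \<le> p x"
  using sublinear_add[of p x "- x"] sublinear_0[of p] by simp

text \<open>The common source of the sublinear functionals constructed below: any sum of members of
  \<open>G x\<close> and \<open>G y\<close> dominates a member of \<open>G (x + y)\<close>, and
  infima inherit this.\<close>

lemma sublinear_Inf:
  fixes G :: "'v::real_vector \<Rightarrow> real set"
  assumes ne: "\<And>x. G x \<noteq> {}"
    and bdd: "\<And>x. bdd_below (G x)"
    and add: "\<And>x y a b. a \<in> G x \<Longrightarrow> b \<in> G y \<Longrightarrow> \<exists>c\<in>G (x + y). c \<le> a + b"
    and scale: "\<And>x a t. a \<in> G x \<Longrightarrow> t > 0 \<Longrightarrow> \<exists>c\<in>G (t *\<^sub>R x). c \<le> t * a"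
  shows "sublinear (\<lambda>x. Inf (G x))"
  unfolding sublinear_def
proof (intro conjI allI impI)
  fix x y
  have "Inf (G (x + y)) - b \<le> a" if "a \<in> G x" "b \<in> G y" for a b
    using add[OF that] cInf_lower2[OF _ _ bdd[of "x + y"]] by fastforce
  then have "Inf (G (x + y)) - b \<le> Inf (G x)" if "b \<in> G y" for b
    using that by (intro cInf_greatest ne) auto
  then have "Inf (G (x + y)) - Inf (G x) \<le> b" if "b \<in> G y" for b
    using that by fastforce
  then have "Inf (G (x + y)) - Inf (G x) \<le> Inf (G y)"
    by (intro cInf_greatest ne) auto
  then show "Inf (G (x + y)) \<le> Inf (G x) + Inf (G y)" by simp
next
  fix t :: real and x assume t: "t > 0"
  have "Inf (G (t *\<^sub>R x)) / t \<le> a" if "a \<in> G x" for a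
  proof -
    from scale[OF that t] obtain c where c: "c \<in> G (t *\<^sub>R x)" "c \<le> t * a" by blast
    have "Inf (G (t *\<^sub>R x)) \<le> t * a" by (rule cInf_lower2[OF c bdd])
    then show ?thesis using t by (simp add: pos_divide_le_eq mult.commute)
  qed
  then have "Inf (G (t *\<^sub>R x)) / t \<le> Inf (G x)"
    by (intro cInf_greatest ne) auto
  then show "Inf (G (t *\<^sub>R x)) \<le> t * Inf (G x)" using t by (simp add: field_simps)
qed

text \<open>A pointwise minimal sublinear functional is linear: lowering its value at \<open>- y\<close> as far as
  sublinearity permits cannot change it.\<close>

lemma linear_if_minimal_sublinear:
  assumes q: "sublinear q"
    and minimal: "\<And>r. sublinear r \<Longrightarrow> r \<le> q \<Longrightarrow> r = q"
  shows "linear q"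
proof -
  have superadd: "q x + q y \<le> q (x + y)" for x y
  proof -
    \<comment> \<open>The infimum of \<open>G x\<close> is sublinear in \<open>x\<close> and below
      \<open>q\<close> by \<open>t = 0\<close>, so minimality makes it equal to \<open>q\<close>;
      then \<open>t = 1\<close> gives superadditivity.\<close>
    define G where "G x = {q (x + t *\<^sub>R y) - t * q y | t. t \<ge> 0}" for x
    have bdd: "bdd_below (G x)" for x
    proof -
      have "- q (- x) \<le> q (x + t *\<^sub>R y) - t * q y" if "t \<ge> 0" for t
        using sublinear_add[OF q, of "x + t *\<^sub>R y" "- x"]
        by (simp add: sublinear_scaleR_nonneg[OF q that])
      then show ?thesis unfolding G_def by (intro bdd_belowI[of _ "- q (- x)"]) auto
    qed
    have "sublinear (\<lambda>x. Inf (G x))"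
    proof (rule sublinear_Inf)
      fix x show "G x \<noteq> {}" unfolding G_def by blast
    next
      fix x z a b assume "a \<in> G x" "b \<in> G z"
      then obtain s t where st: "s \<ge> 0" "t \<ge> 0" "a = q (x + s *\<^sub>R y) - s * q y"
        "b = q (z + t *\<^sub>R y) - t * q y" unfolding G_def by blast
      have "q ((x + z) + (s + t) *\<^sub>R y) \<le> q (x + s *\<^sub>R y) + q (z + t *\<^sub>R y)"
        using sublinear_add[OF q, of "x + s *\<^sub>R y" "z + t *\<^sub>R y"] by (simp add: algebra_simps)
      then show "\<exists>c\<in>G (x + z). c \<le> a + b"
        using st by (intro bexI[of _ "q ((x + z) + (s + t) *\<^sub>R y) - (s + t) * q y"])
          (auto simp: G_def algebra_simps intro!: exI[of _ "s + t"])
    next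
      fix x a and t :: real assume "a \<in> G x" and t: "t > 0"
      then obtain s where s: "s \<ge> 0" "a = q (x + s *\<^sub>R y) - s * q y" unfolding G_def by blast
      have "q (t *\<^sub>R x + (t * s) *\<^sub>R y) = t * q (x + s *\<^sub>R y)"
        using sublinear_scaleR_pos[OF q t, of "x + s *\<^sub>R y"] by (simp add: algebra_simps)
      then have "q (t *\<^sub>R x + (t * s) *\<^sub>R y) - (t * s) * q y = t * a"
        unfolding s(2) by (simp add: algebra_simps)
      then have "t * a \<in> G (t *\<^sub>R x)"
        using s(1) t unfolding G_def by (auto intro!: exI[of _ "t * s"])
      then show "\<exists>c\<in>G (t *\<^sub>R x). c \<le> t * a" by blast
    qed (rule bdd)
    moreover have "Inf (G x) \<le> q x" for x
      by (rule cInf_lower[OF _ bdd]) (auto simp: G_def intro!: exI[of _ 0])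
    ultimately have "(\<lambda>x. Inf (G x)) = q"
      by (intro minimal) (auto simp: le_fun_def)
    moreover have "Inf (G x) \<le> q (x + y) - q y"
      by (rule cInf_lower[OF _ bdd]) (auto simp: G_def intro!: exI[of _ 1])
    ultimately show ?thesis by (metis le_diff_eq)
  qed
  have add: "q (x + y) = q x + q y" for x y
    using superadd sublinear_add[OF q] by (simp add: antisym)
  have neg: "q (- x) = - q x" for x
    using add[of x "- x"] sublinear_0[OF q] by simp
  show ?thesis
  proof (rule linearI)
    fix c :: real and x
    show "q (c *\<^sub>R x) = c *\<^sub>R q x"
    proof (cases "c \<ge> 0")
      case False
      then show ?thesis using sublinear_scaleR_pos[OF q, of "- c" x] neg by simp
    qed (simp add: sublinear_scaleR_nonneg[OF q])
  qed (rule add)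
qed

text \<open>Zorn's lemma supplies a minimal sublinear functional below \<open>p\<close>, which is
  linear by the preceding lemma.\<close>

theorem hahn_banach:
  fixes p :: "'v::real_vector \<Rightarrow> real"
  assumes p: "sublinear p"
  shows "\<exists>f. linear f \<and> (\<forall>x. f x \<le> p x)"
proof -
  define A where "A = {q. sublinear q \<and> q \<le> p}"
  have "\<exists>m\<in>A. \<forall>a\<in>A. m \<ge> a \<longrightarrow> a = m"
  \<comment> \<open>Under the reversed order, maximal elements are pointwise minimal, and a chain is
    bounded by its pointwise infimum.\<close>
  proof (rule predicate_Zorn)
    show "partial_order_on A (relation_of (\<ge>) A)"
      by (rule partial_order_on_relation_ofI) auto
  next
    fix C assume C: "C \<in> Chains (relation_of (\<ge>) A)"
    show "\<exists>u\<in>A. \<forall>a\<in>C. u \<le> a"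
    proof (cases "C = {}")
      case True
      then show ?thesis using p by (auto simp: A_def)
    next
      case False
      have CA: "C \<subseteq> A" using C by (auto simp: Chains_def relation_of_def)
      have total: "q \<le> r \<or> r \<le> q" if "q \<in> C" "r \<in> C" for q r
        using C that by (auto simp: Chains_def relation_of_def)
      define G where "G x = (\<lambda>q. q x) ` C" for x
      have bdd: "bdd_below (G x)" for x
      proof -
        \<comment> \<open>A bound independent of \<open>q\<close>, which makes the infimum over the
          chain finite.\<close>
        have "- p (- x) \<le> q x" if "q \<in> C" for q
        proof -
          have "sublinear q" "q (- x) \<le> p (- x)" using that CA by (auto simp: A_def le_fun_def)
          then show ?thesis using sublinear_minus_le[of q x] by linarith
        qed
        then show ?thesis unfolding G_def by (intro bdd_belowI) auto
      qed
      have sub: "sublinear (\<lambda>x. Inf (G x))"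
      proof (rule sublinear_Inf)
        fix x y a b assume "a \<in> G x" "b \<in> G y"
        then obtain q r where qr: "q \<in> C" "r \<in> C" "a = q x" "b = r y" by (auto simp: G_def)
        \<comment> \<open>Members of a chain are comparable, so one \<open>s\<close> lies below both
          and its own subadditivity applies.\<close>
        then obtain s where s: "s \<in> C" "s \<le> q" "s \<le> r" using total by blast
        have "sublinear s" using s CA by (auto simp: A_def)
        then have "s (x + y) \<le> s x + s y" by (rule sublinear_add)
        also have "\<dots> \<le> q x + r y" using s by (intro add_mono) (simp_all add: le_fun_def)
        finally have "s (x + y) \<le> a + b" using qr by simp
        then show "\<exists>c\<in>G (x + y). c \<le> a + b" using s qr by (auto simp: G_def)
      next
        fix x a and t :: real assume "a \<in> G x" "t > 0"
        then show "\<exists>c\<in>G (t *\<^sub>R x). c \<le> t * a"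
          using CA by (auto simp: G_def A_def sublinear_def)
      qed (use False bdd in \<open>auto simp: G_def\<close>)
      have le: "Inf (G x) \<le> q x" if "q \<in> C" for q x
        using that by (intro cInf_lower bdd) (auto simp: G_def)
      obtain q where "q \<in> C" using False by blast
      then have "(\<lambda>x. Inf (G x)) \<le> p" using le[of q] CA by (force simp: A_def le_fun_def intro: order_trans)
      then show ?thesis using sub le by (auto simp: A_def le_fun_def)
    qed
  qed
  then obtain m where m: "sublinear m" "m \<le> p" and min: "\<And>a. a \<in> A \<Longrightarrow> a \<le> m \<Longrightarrow> a = m"
    unfolding A_def by blast
  have "linear m"
    using m min by (intro linear_if_minimal_sublinear) (auto simp: A_def intro: order_trans)
  then show ?thesis using m(2) by (auto simp: le_fun_def)
qed

text \<open>The sublinear functional here is \<open>v \<mapsto> inf {\<parallel>v - t (c - x)\<parallel> - t e | t \<ge> 0, c \<in> C}\<close>.\<close>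

lemma strict_separation_point_convex:
  fixes C :: "'a::real_normed_vector set"
  assumes C: "convex C" "C \<noteq> {}" and dist: "\<And>c. c \<in> C \<Longrightarrow> e \<le> norm (x - c)"
  shows "\<exists>f :: 'a \<Rightarrow>\<^sub>L real. norm f \<le> 1 \<and> (\<forall>c\<in>C. blinfun_apply f c + e \<le> blinfun_apply f x)"
proof -
  define G where "G v = {norm (v - t *\<^sub>R (c - x)) - t * e | t c. t \<ge> 0 \<and> c \<in> C}" for v
  have bdd: "bdd_below (G v)" for v
  proof -
    have "- norm v \<le> norm (v - t *\<^sub>R (c - x)) - t * e" if "t \<ge> 0" "c \<in> C" for t c
    proof -
      \<comment> \<open>The distance hypothesis absorbs the subtracted \<open>t * e\<close>.\<close>
      have "t * e \<le> norm (t *\<^sub>R (c - x))"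
        using dist[OF that(2)] that(1) by (simp add: norm_minus_commute mult_left_mono)
      also have "\<dots> \<le> norm (v - t *\<^sub>R (c - x)) + norm v"
        by (metis norm_minus_commute norm_triangle_sub add.commute)
      finally show ?thesis by simp
    qed
    then show ?thesis unfolding G_def by (intro bdd_belowI[of _ "- norm v"]) auto
  qed
  have "sublinear (\<lambda>v. Inf (G v))"
  proof (rule sublinear_Inf)
    fix v show "G v \<noteq> {}" using C unfolding G_def by force
  next
    fix v w a b assume "a \<in> G v" "b \<in> G w"
    then obtain t c s d where *: "t \<ge> 0" "c \<in> C" "a = norm (v - t *\<^sub>R (c - x)) - t * e"
       "s \<ge> 0" "d \<in> C" "b = norm (w - s *\<^sub>R (d - x)) - s * e" unfolding G_def by blast
    \<comment> \<open>A convex combination with weights proportional to \<open>t\<close> and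
      \<open>s\<close>; if both vanish, any point of \<open>C\<close> serves.\<close>
    obtain u where u: "u \<in> C" "(t + s) *\<^sub>R u = t *\<^sub>R c + s *\<^sub>R d"
    proof (cases "t + s = 0")
      case True
      then have "t = 0" "s = 0" using * by auto
      then show ?thesis using that * by simp
    next
      case False
      then have "t + s > 0" using * by auto
      moreover from this have "t / (t + s) + s / (t + s) = 1"
        by (simp add: add_divide_distrib[symmetric])
      ultimately have "(t / (t + s)) *\<^sub>R c + (s / (t + s)) *\<^sub>R d \<in> C"
        using * by (intro convexD[OF C(1)]) simp_all
      then show ?thesis by (rule that) (use \<open>t + s > 0\<close> in \<open>simp add: scaleR_add_right\<close>)
    qed
    have "(v + w) - (t + s) *\<^sub>R (u - x) = (v - t *\<^sub>R (c - x)) + (w - s *\<^sub>R (d - x))"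
      using u(2) by (simp add: algebra_simps)
    then have "norm ((v + w) - (t + s) *\<^sub>R (u - x)) \<le> norm (v - t *\<^sub>R (c - x)) + norm (w - s *\<^sub>R (d - x))"
      by (simp only: norm_triangle_ineq)
    then have "norm ((v + w) - (t + s) *\<^sub>R (u - x)) - (t + s) * e \<le> a + b"
      unfolding *(3,6) distrib_right by linarith
    moreover have "norm ((v + w) - (t + s) *\<^sub>R (u - x)) - (t + s) * e \<in> G (v + w)"
      using * u(1) unfolding G_def by (intro CollectI exI[of _ "t + s"] exI[of _ u]) auto
    ultimately show "\<exists>c\<in>G (v + w). c \<le> a + b" by blast
  next
    fix v a and s :: real assume "a \<in> G v" and s: "s > 0"
    then obtain t c where *: "t \<ge> 0" "c \<in> C" "a = norm (v - t *\<^sub>R (c - x)) - t * e"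
      unfolding G_def by blast
    have "s *\<^sub>R v - (s * t) *\<^sub>R (c - x) = s *\<^sub>R (v - t *\<^sub>R (c - x))"
      by (simp add: algebra_simps)
    then have "norm (s *\<^sub>R v - (s * t) *\<^sub>R (c - x)) - (s * t) * e = s * a"
      using * s by (simp add: right_diff_distrib)
    then have "s * a \<in> G (s *\<^sub>R v)"
      using * s unfolding G_def by (intro CollectI exI[of _ "s * t"] exI[of _ c]) auto
    then show "\<exists>c\<in>G (s *\<^sub>R v). c \<le> s * a" by blast
  qed (rule bdd)
  then obtain f where f: "linear f" "\<And>v. f v \<le> Inf (G v)" using hahn_banach by blast
  obtain c0 where c0: "c0 \<in> C" using C by blast
  have f1: "f v \<le> norm v" for v
  proof -
    \<comment> \<open>The member with \<open>t = 0\<close> bounds \<open>f\<close> by the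
      norm.\<close>
    have "norm (v - 0 *\<^sub>R (c0 - x)) - 0 * e \<in> G v" unfolding G_def using c0 by blast
    then have "Inf (G v) \<le> norm v" using cInf_lower[OF _ bdd] by simp
    then show ?thesis using f(2)[of v] by simp
  qed
  have f2: "norm (f v) \<le> 1 * norm v" for v
    using f1[of v] f1[of "- v"] linear_neg[OF f(1), of v] by (auto simp: abs_le_iff)
  have fC: "f c + e \<le> f x" if "c \<in> C" for c
  proof -
    \<comment> \<open>With \<open>t = 1\<close> the norm term vanishes at \<open>c - x\<close> and
      leaves \<open>- e\<close>.\<close>
    have "norm ((c - x) - 1 *\<^sub>R (c - x)) - 1 * e \<in> G (c - x)"
      unfolding G_def using that zero_le_one by blast
    then have "Inf (G (c - x)) \<le> - e" using cInf_lower[OF _ bdd, of _ "c - x"] by simp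
    then show ?thesis using f(2)[of "c - x"] linear_diff[OF f(1), of c x] by simp
  qed
  have "bounded_linear f"
    using f(1) f2 by (intro bounded_linear_intro[of _ 1]) (auto simp: linear_add linear_scale mult.commute)
  then have "blinfun_apply (Blinfun f) = f" by (rule bounded_linear_Blinfun_apply)
  moreover from this have "norm (Blinfun f) \<le> 1"
    using f2 by (intro norm_blinfun_bound) simp_all
  ultimately show ?thesis using fC by (intro exI[of _ "Blinfun f"]) simp
qed

lemma norming_functional:
  fixes x :: "'a::real_normed_vector"
  obtains f :: "'a \<Rightarrow>\<^sub>L real" where "norm f \<le> 1" "norm x \<le> blinfun_apply f x"
  using strict_separation_point_convex[of "{0}" "norm x" x] by auto

section \<open>Finite minimax and the James sequence\<close>

text \<open>The image of \<open>B\<close> in the plane is convex and misses the open quadrant above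
  \<open>(c, d)\<close>. A separating line has a normal with nonnegative coordinates; scaling them
  to sum 1 gives the weights.\<close>

lemma minimax_two_functionals:
  fixes f g :: "'v::real_vector \<Rightarrow> real"
  assumes "convex B" "linear f" "linear g" and none: "\<And>y. y \<in> B \<Longrightarrow> f y > c \<Longrightarrow> g y > d \<Longrightarrow> False"
  shows "\<exists>u\<ge>0. \<exists>v\<ge>0. u + v = 1 \<and> (\<forall>y\<in>B. u * f y + v * g y \<le> u * c + v * d)"
proof (cases "B = {}")
  case True
  then show ?thesis by (intro exI[of _ 1] conjI exI[of _ 0]) auto
next
  case False
  define S where "S = (\<lambda>y. (f y, g y)) ` B"
  have "linear (\<lambda>y. (f y, g y))"
    using assms(2,3) by (auto simp: linear_iff)
  then have "convex S"
    unfolding S_def using assms(1) by (rule convex_linear_image)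
  moreover have "convex ({c<..} \<times> {d<..})" by (intro convex_Times) auto
  moreover have "S \<noteq> {}" "{c<..} \<times> {d<..} \<noteq> {}" using False by (auto simp: S_def)
  moreover have "S \<inter> {c<..} \<times> {d<..} = {}" using none by (auto simp: S_def)
  ultimately obtain a b where ab: "a \<noteq> 0" "\<And>x. x \<in> S \<Longrightarrow> a \<bullet> x \<le> b"
    "\<And>x. x \<in> {c<..} \<times> {d<..} \<Longrightarrow> b \<le> a \<bullet> x"
    using separating_hyperplane_sets by metis
  obtain p q where a: "a = (p, q)" by (cases a)
  have ge: "b \<le> p * (c + s) + q * (d + t)" if "s > 0" "t > 0" for s t
    using ab(3)[of "(c + s, d + t)"] that by (simp add: a)
  \<comment> \<open>A lower bound along a whole ray forces a nonnegative slope; the quadrant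
    contains such rays in both coordinate directions.\<close>
  have lim: "0 \<le> r" if "\<And>t. t > 0 \<Longrightarrow> m \<le> r * t" for r m :: real
  proof (rule ccontr)
    assume "\<not> 0 \<le> r"
    then have "r < 0" by simp
    moreover have "m \<le> r * ((\<bar>m\<bar> + 1) / - r)"
      using \<open>r < 0\<close> by (intro that) (auto simp: divide_pos_pos divide_pos_neg)
    ultimately show False by simp
  qed
  have p: "0 \<le> p"
    using ge[of _ 1] by (intro lim[of "b - p * c - q * (d + 1)"]) (auto simp: algebra_simps)
  have q: "0 \<le> q"
    using ge[of 1] by (intro lim[of "b - p * (c + 1) - q * d"]) (auto simp: algebra_simps)
  have pq: "p + q > 0" using p q ab(1) by (auto simp: a zero_prod_def add_nonneg_eq_0_iff less_le)
  \<comment> \<open>The quadrant comes arbitrarily close to its corner \<open>(c, d)\<close>; the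
    shift \<open>e / (p + q)\<close> costs exactly \<open>e\<close>.\<close>
  have b: "b \<le> p * c + q * d"
  proof (rule field_le_epsilon)
    fix e :: real assume "e > 0"
    then have "p * (e / (p + q)) + q * (e / (p + q)) = e"
      using pq by (simp flip: distrib_right add_divide_distrib)
    with \<open>e > 0\<close> show "b \<le> p * c + q * d + e"
      using ge[of "e / (p + q)" "e / (p + q)"] pq by (simp add: distrib_left)
  qed
  have *: "p * f y + q * g y \<le> p * c + q * d" if "y \<in> B" for y
    using ab(2)[of "(f y, g y)"] that b by (auto simp: a S_def)
  have "p / (p + q) * f y + q / (p + q) * g y \<le> p / (p + q) * c + q / (p + q) * d" if "y \<in> B" for y
    using divide_right_mono[OF *[OF that], of "p + q"] pq by (simp add: add_divide_distrib)
  moreover have "p / (p + q) + q / (p + q) = 1" using pq by (simp add: add_divide_distrib[symmetric])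
  moreover have "p / (p + q) \<ge> 0" "q / (p + q) \<ge> 0" using p q by simp_all
  ultimately show ?thesis by blast
qed

text \<open>Induction on \<open>S\<close>: on the convex part of \<open>B\<close> where the new
  functional exceeds its threshold, the old pairs merge into one \<open>(f, c)\<close>, and the
  two-functional case merges this with the new pair. Pairing functionals with thresholds gives both
  the same convex weights.\<close>

lemma minimax_finite:
  fixes S :: "(('a::real_normed_vector \<Rightarrow>\<^sub>L real) \<times> real) set"
  assumes "finite S" "S \<noteq> {}" "convex B"
    and "\<And>y. y \<in> B \<Longrightarrow> \<exists>(f, c)\<in>S. blinfun_apply f y \<le> c"
  shows "\<exists>(f, c)\<in>convex hull S. \<forall>y\<in>B. blinfun_apply f y \<le> c"
  using assms
proof (induction S arbitrary: B rule: finite_ne_induct)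
  case (singleton s)
  then show ?case by auto
next
  case (insert s S)
  obtain g d where s: "s = (g, d)" by (cases s)
  have lin: "linear (blinfun_apply h)" for h :: "'a \<Rightarrow>\<^sub>L real"
    by (auto simp: linear_iff blinfun.add_right blinfun.scaleR_right)
  have "convex (B \<inter> blinfun_apply g -` {d<..})"
    by (intro convex_Int insert.prems(1) convex_linear_vimage lin) simp
  then have "\<exists>(f, c)\<in>convex hull S. \<forall>y\<in>B \<inter> blinfun_apply g -` {d<..}. blinfun_apply f y \<le> c"
    using insert.prems(2) by (intro insert.IH) (force simp: s)+
  then obtain f c where fc: "(f, c) \<in> convex hull S"
    "\<And>y. y \<in> B \<Longrightarrow> blinfun_apply f y > c \<Longrightarrow> blinfun_apply g y > d \<Longrightarrow> False"
    by force
  have "\<exists>u\<ge>0. \<exists>v\<ge>0. u + v = 1 \<and>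
      (\<forall>y\<in>B. u * blinfun_apply f y + v * blinfun_apply g y \<le> u * c + v * d)"
    by (rule minimax_two_functionals[OF insert.prems(1) lin lin]) (rule fc(2))
  then obtain u v where uv: "u \<ge> 0" "v \<ge> 0" "u + v = 1"
    "\<And>y. y \<in> B \<Longrightarrow> u * blinfun_apply f y + v * blinfun_apply g y \<le> u * c + v * d"
    by blast
  have "(f, c) \<in> convex hull (insert s S)"
    using fc(1) hull_mono[of S "insert s S"] by blast
  moreover have "(g, d) \<in> convex hull (insert s S)"
    by (simp add: s hull_inc)
  ultimately have "u *\<^sub>R (f, c) + v *\<^sub>R (g, d) \<in> convex hull (insert s S)"
    using uv by (intro convexD) auto
  moreover have "u *\<^sub>R (f, c) + v *\<^sub>R (g, d) = (u *\<^sub>R f + v *\<^sub>R g, u * c + v * d)" by simp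
  ultimately have "(u *\<^sub>R f + v *\<^sub>R g, u * c + v * d) \<in> convex hull (insert s S)" by simp
  then show ?case
    by (rule rev_bexI) (simp add: uv(4) blinfun.add_left blinfun.scaleR_left)
qed

lemma norm_blinfun_le_if_le_on_cball:
  fixes f :: "'a::real_normed_vector \<Rightarrow>\<^sub>L real"
  assumes "\<And>y. norm y \<le> 1 \<Longrightarrow> blinfun_apply f y \<le> c"
  shows "norm f \<le> c"
proof (rule norm_blinfun_bound)
  show "0 \<le> c" using assms[of 0] by simp
  fix y
  show "norm (blinfun_apply f y) \<le> c * norm y"
  proof (cases "y = 0")
    case False
    then have "blinfun_apply f (sgn y) \<le> c" "blinfun_apply f (- sgn y) \<le> c"
      using assms by (auto simp: norm_sgn)
    then have "\<bar>blinfun_apply f (sgn y)\<bar> \<le> c" by (simp add: blinfun.minus_right abs_le_iff)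
    then have "\<bar>blinfun_apply f (sgn y)\<bar> * norm y \<le> c * norm y"
      by (rule mult_right_mono) simp
    moreover have "blinfun_apply f y = blinfun_apply f (sgn y) * norm y"
      using False by (simp add: sgn_div_norm blinfun.scaleR_right)
    ultimately show ?thesis by (simp add: abs_mult)
  qed simp
qed

lemma blinfun_apply_le_norm:
  fixes f :: "'a::real_normed_vector \<Rightarrow>\<^sub>L real"
  assumes "norm y \<le> 1"
  shows "blinfun_apply f y \<le> norm f"
  using norm_blinfun[of f y] mult_left_mono[OF assms norm_ge_zero[of f]] by (simp add: abs_le_iff)

section \<open>Goldstine's theorem and the canonical embedding\<close>

text \<open>If no ball point worked, minimax would give a convex combination \<open>f\<close> of
  members of \<open>A\<close> bounded by \<open>F f - e\<close> on the ball. Then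
  \<open>norm f \<le> F f - e\<close>, although \<open>F f \<le> norm f\<close>.\<close>

lemma goldstine:
  fixes F :: "('a::real_normed_vector \<Rightarrow>\<^sub>L real) \<Rightarrow>\<^sub>L real"
  assumes F: "norm F \<le> 1" and "finite A" "e > 0"
  shows "\<exists>y. norm y \<le> 1 \<and> (\<forall>f\<in>A. blinfun_apply F f - e < blinfun_apply f y)"
proof (rule ccontr)
  assume none: "\<not> ?thesis"
  then have "A \<noteq> {}" by (metis empty_iff norm_zero zero_le_one)
  define S where "S = (\<lambda>f. (f, blinfun_apply F f - e)) ` A"
  have "\<exists>(f, c)\<in>convex hull S. \<forall>y\<in>cball 0 1. blinfun_apply f y \<le> c"
    using \<open>A \<noteq> {}\<close> \<open>finite A\<close> none by (intro minimax_finite) (auto simp: S_def not_less)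
  then obtain f c where fc: "(f, c) \<in> convex hull S"
    "\<And>y. norm y \<le> 1 \<Longrightarrow> blinfun_apply f y \<le> c" by auto
  \<comment> \<open>The graph of an affine map is convex, so the threshold paired with a convex
    combination \<open>f\<close> is still \<open>F f - e\<close>.\<close>
  have "convex {(f, c). c = blinfun_apply F f - e}"
  proof (rule convexI)
    fix x y and u v :: real
    assume *: "x \<in> {(f, c). c = blinfun_apply F f - e}" "y \<in> {(f, c). c = blinfun_apply F f - e}"
      "u + v = 1"
    have "u * e + v * e = e" using *(3) by (metis distrib_right mult_1)
    then show "u *\<^sub>R x + v *\<^sub>R y \<in> {(f, c). c = blinfun_apply F f - e}"
      using * by (auto simp: blinfun.add_right blinfun.scaleR_right right_diff_distrib)
  qed
  then have "convex hull S \<subseteq> {(f, c). c = blinfun_apply F f - e}"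
    by (intro hull_minimal) (auto simp: S_def)
  then have "c = blinfun_apply F f - e" using fc(1) by auto
  moreover have "norm f \<le> c" by (rule norm_blinfun_le_if_le_on_cball) (rule fc(2))
  moreover have "blinfun_apply F f \<le> norm f"
    using norm_blinfun[of F f] mult_right_mono[OF F norm_ge_zero[of f]] by (simp add: abs_le_iff)
  ultimately show False using \<open>e > 0\<close> by simp
qed

text \<open>The canonical embedding into the real second dual, here a type of bounded linear maps,
  so that the norm and topology of that type are available.\<close>

definition evaluation :: "'a::real_normed_vector \<Rightarrow> ('a \<Rightarrow>\<^sub>L real) \<Rightarrow>\<^sub>L real" where
  "evaluation x = Blinfun (\<lambda>f. blinfun_apply f x)"

lemma evaluation_apply [simp]: "blinfun_apply (evaluation x) f = blinfun_apply f x"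
  unfolding evaluation_def by (subst bounded_linear_Blinfun_apply) (auto intro!: bounded_linear_intros)

lemma norm_evaluation: "norm (evaluation x) = norm x"
proof (rule antisym)
  show "norm (evaluation x) \<le> norm x"
  proof (rule norm_blinfun_bound)
    fix f :: "'a \<Rightarrow>\<^sub>L real"
    show "norm (blinfun_apply (evaluation x) f) \<le> norm x * norm f"
      using norm_blinfun[of f x] by (simp add: mult.commute)
  qed simp
  obtain f :: "'a \<Rightarrow>\<^sub>L real" where "norm f \<le> 1" "norm x \<le> blinfun_apply f x"
    by (rule norming_functional)
  then show "norm x \<le> norm (evaluation x)"
    using blinfun_apply_le_norm[of f "evaluation x"] by simp
qed

lemma bounded_linear_evaluation: "bounded_linear evaluation"
  by (rule bounded_linear_intro[of _ 1])
    (auto intro!: blinfun_eqI simp: norm_evaluation blinfun.add_left blinfun.add_right blinfun.scaleR_left blinfun.scaleR_right)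

lemmas linear_evaluation = bounded_linear.linear[OF bounded_linear_evaluation]

text \<open>Completeness of the space enters here: its isometric image is complete, hence
  closed.\<close>

lemma dist_range_evaluation_pos:
  fixes F :: "('a::banach \<Rightarrow>\<^sub>L real) \<Rightarrow>\<^sub>L real"
  assumes "F \<notin> range evaluation"
  shows "\<exists>d>0. \<forall>x. d < norm (F - evaluation x)"
proof -
  have "complete (range (evaluation :: 'a \<Rightarrow> _))"
    by (rule complete_isometric_image[of 1])
      (auto simp: bounded_linear_evaluation norm_evaluation complete_UNIV)
  then have "open (- range (evaluation :: 'a \<Rightarrow> _))"
    using complete_imp_closed by blast
  then obtain d where d: "d > 0" "ball F d \<subseteq> - range (evaluation :: 'a \<Rightarrow> _)"
    using assms by (meson ComplI open_contains_ball)
  have "d / 2 < norm (F - evaluation x)" for x :: 'a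
  proof -
    have "evaluation x \<notin> ball F d" using d(2) by blast
    then show ?thesis using d(1) by (simp add: dist_norm)
  qed
  then show ?thesis using d(1) by (intro exI[of _ "d / 2"]) auto
qed

text \<open>Minimax on the unit ball of the dual, for the functionals
  \<open>F - evaluation x\<close> with common threshold \<open>d\<close>: failure would give a
  convex combination of norm at most \<open>d\<close>.\<close>

lemma functional_separating_bidual_element:
  fixes F :: "('a::real_normed_vector \<Rightarrow>\<^sub>L real) \<Rightarrow>\<^sub>L real"
  assumes far: "\<And>x. d < norm (F - evaluation x)" and "finite A"
  shows "\<exists>f. norm f \<le> 1 \<and> (\<forall>x\<in>A. blinfun_apply f x + d < blinfun_apply F f)"
proof (rule ccontr)
  assume none: "\<not> ?thesis"
  then have "A \<noteq> {}" by (metis empty_iff norm_zero zero_le_one)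
  define S where "S = (\<lambda>x. (F - evaluation x, d)) ` A"
  have "\<exists>(G, c)\<in>S. blinfun_apply G f \<le> c" if "f \<in> cball 0 1" for f
  proof -
    have "norm f \<le> 1" using that by simp
    then obtain x where "x \<in> A" "blinfun_apply F f \<le> blinfun_apply f x + d"
      using none by (meson not_less)
    then show ?thesis by (force simp: S_def blinfun.diff_left)
  qed
  then have "\<exists>(G, c)\<in>convex hull S. \<forall>f\<in>cball 0 1. blinfun_apply G f \<le> c"
    using \<open>A \<noteq> {}\<close> \<open>finite A\<close> by (intro minimax_finite) (auto simp: S_def)
  then obtain G c where Gc: "(G, c) \<in> convex hull S"
    "\<And>f. norm f \<le> 1 \<Longrightarrow> blinfun_apply G f \<le> c" by auto
  \<comment> \<open>Weights of sum 1 fix \<open>F\<close> and \<open>d\<close>, so a convex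
    combination is again \<open>F\<close> minus an evaluation and \<open>far\<close> applies to
    it.\<close>
  have "convex (range (\<lambda>x. (F - evaluation x, d)))"
  proof (rule convexI)
    fix p q and u v :: real
    assume *: "p \<in> range (\<lambda>x. (F - evaluation x, d))" "q \<in> range (\<lambda>x. (F - evaluation x, d))"
      "u + v = 1"
    then obtain x y where xy: "p = (F - evaluation x, d)" "q = (F - evaluation y, d)" by blast
    have "u *\<^sub>R F + v *\<^sub>R F = F" "u * d + v * d = d"
      using *(3) by (metis scaleR_add_left scaleR_one, metis distrib_right mult_1)
    moreover have "evaluation (u *\<^sub>R x + v *\<^sub>R y) = u *\<^sub>R evaluation x + v *\<^sub>R evaluation y"
      by (simp add: linear_add[OF linear_evaluation] linear_scale[OF linear_evaluation])
    ultimately have "u *\<^sub>R p + v *\<^sub>R q = (F - evaluation (u *\<^sub>R x + v *\<^sub>R y), d)"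
      by (simp add: xy algebra_simps)
    then show "u *\<^sub>R p + v *\<^sub>R q \<in> range (\<lambda>x. (F - evaluation x, d))" by blast
  qed
  then have "convex hull S \<subseteq> range (\<lambda>x. (F - evaluation x, d))"
    by (intro hull_minimal) (auto simp: S_def)
  then obtain x where "G = F - evaluation x" "c = d" using Gc(1) by auto
  moreover have "norm G \<le> c" by (rule norm_blinfun_le_if_le_on_cball) (rule Gc(2))
  ultimately show False using far[of x] by simp
qed

section \<open>James sequences and the lower bound for \<open>R_const\<close>\<close>

lemma james_sequence:
  fixes F :: "('a::real_normed_vector \<Rightarrow>\<^sub>L real) \<Rightarrow>\<^sub>L real"
  assumes F: "norm F \<le> 1" and d: "d > 0" and far: "\<And>x. d < norm (F - evaluation x)"
  shows "\<exists>x :: nat \<Rightarrow> 'a. range x \<subseteq> cball 0 1 \<and>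
    (\<forall>m. \<forall>u\<in>convex hull (x ` {..<m}). \<forall>v\<in>convex hull (x ` {m..}). d / 2 \<le> norm (u - v))"
proof -
  have "\<forall>A. finite A \<longrightarrow> (\<exists>f. norm f \<le> 1 \<and> (\<forall>x\<in>A. blinfun_apply f x + d < blinfun_apply F f))"
    using functional_separating_bidual_element[OF far] by blast
  \<comment> \<open>With the functional a fixed function of the finite set of earlier points, only
    \<open>x\<close> has to be built recursively.\<close>
  then obtain g where g: "\<And>A. finite A \<Longrightarrow> norm (g A) \<le> 1"
    "\<And>A x. finite A \<Longrightarrow> x \<in> A \<Longrightarrow> blinfun_apply (g A) x + d < blinfun_apply F (g A)"
    by metis
  define P where "P x n r \<longleftrightarrow> norm r \<le> 1 \<and>
     (\<forall>m\<le>n. blinfun_apply F (g (x ` {..<m})) - d / 2 < blinfun_apply (g (x ` {..<m})) r)"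
    for x :: "nat \<Rightarrow> 'a" and n r
  have "\<exists>x. \<forall>n. P x n (x n)"
  proof (rule dependent_wellorder_choice)
    fix r n and x y :: "nat \<Rightarrow> 'a" assume eq: "\<And>i. i < n \<Longrightarrow> x i = y i"
    have "x ` {..<m} = y ` {..<m}" if "m \<le> n" for m using eq that by (intro image_cong) auto
    then show "P x n r = P y n r" by (simp add: P_def)
  next
    fix n and x :: "nat \<Rightarrow> 'a"
    \<comment> \<open>Goldstine handles all functionals chosen up to stage \<open>n\<close> at
      once.\<close>
    show "\<exists>r. P x n r" unfolding P_def
      using goldstine[OF F, of "(\<lambda>m. g (x ` {..<m})) ` {..n}" "d / 2"] d by auto
  qed
  then obtain x where "\<And>n. P x n (x n)" by blast
  then have x: "\<And>n. norm (x n) \<le> 1" "\<And>m n. m \<le> n \<Longrightarrow>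
     blinfun_apply F (g (x ` {..<m})) - d / 2 < blinfun_apply (g (x ` {..<m})) (x n)"
    by (simp_all add: P_def)
  have "d / 2 \<le> norm (u - v)" if uv: "u \<in> convex hull (x ` {..<m})" "v \<in> convex hull (x ` {m..})" for m u v
  proof -
    define f where "f = g (x ` {..<m})"
    have lin: "linear (blinfun_apply f)"
      by (auto simp: linear_iff blinfun.add_right blinfun.scaleR_right)
    \<comment> \<open>Half-spaces are convex, so the gap between the values of \<open>f\<close>
      before and after \<open>m\<close> passes to the hulls; \<open>norm f \<le> 1\<close> turns it
      into a distance.\<close>
    have "blinfun_apply f (x i) + d < blinfun_apply F f" if "i < m" for i
      unfolding f_def using that by (intro g(2)) auto
    then have "x ` {..<m} \<subseteq> blinfun_apply f -` {..blinfun_apply F f - d}"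
      by (force simp: le_diff_eq)
    then have "convex hull (x ` {..<m}) \<subseteq> blinfun_apply f -` {..blinfun_apply F f - d}"
      by (rule hull_minimal) (intro convex_linear_vimage lin convex_real_interval)
    moreover have "blinfun_apply F f - d / 2 < blinfun_apply f (x i)" if "m \<le> i" for i
      unfolding f_def using that by (rule x(2))
    then have "x ` {m..} \<subseteq> blinfun_apply f -` {blinfun_apply F f - d / 2..}"
      by (force intro: less_imp_le)
    then have "convex hull (x ` {m..}) \<subseteq> blinfun_apply f -` {blinfun_apply F f - d / 2..}"
      by (rule hull_minimal) (intro convex_linear_vimage lin convex_real_interval)
    ultimately have "blinfun_apply f u \<le> blinfun_apply F f - d" "blinfun_apply F f - d / 2 \<le> blinfun_apply f v"
      using uv by auto
    then have "d / 2 \<le> blinfun_apply f (v - u)" by (simp add: blinfun.diff_right)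
    also have "\<dots> \<le> norm f * norm (v - u)" using norm_blinfun[of f "v - u"] by simp
    also have "\<dots> \<le> norm (u - v)"
      using g(1)[of "x ` {..<m}"] mult_right_mono[of "norm f" 1 "norm (v - u)"]
      by (simp add: f_def norm_minus_commute)
    finally show ?thesis .
  qed
  then show ?thesis using x(1) by (intro exI[of _ x]) auto
qed

text \<open>Consecutive convex blocks of a James sequence are separated by a cut into initial
  segment and tail, so every tail of a convex block subsequence contains two points at distance at
  least \<open>d / 2\<close>.\<close>

lemma R_const_pos_if_not_surj_evaluation:
  assumes "\<not> surj (evaluation :: 'a::banach \<Rightarrow> _)"
  shows "0 < R_const TYPE('a)"
proof -
  obtain F0 where F0: "F0 \<notin> range (evaluation :: 'a \<Rightarrow> _)" using assms by blast
  have "F0 \<noteq> 0"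
    using F0 linear_0[OF linear_evaluation] by (metis rangeI)
  \<comment> \<open>The James construction asks for norm at most 1; the range of
    \<open>evaluation\<close> is a subspace, so rescaling does not move \<open>F0\<close> into
    it.\<close>
  define F where "F = inverse (norm F0) *\<^sub>R F0"
  have "norm F \<le> 1" using \<open>F0 \<noteq> 0\<close> by (simp add: F_def)
  have "F \<notin> range (evaluation :: 'a \<Rightarrow> _)"
  proof
    assume "F \<in> range (evaluation :: 'a \<Rightarrow> _)"
    then obtain x :: 'a where "F = evaluation x" by blast
    then have "evaluation (norm F0 *\<^sub>R x) = norm F0 *\<^sub>R F"
      by (simp add: linear_scale[OF linear_evaluation])
    then have "F0 = evaluation (norm F0 *\<^sub>R x)"
      using \<open>F0 \<noteq> 0\<close> by (simp add: F_def)
    then show False using F0 by blast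
  qed
  then obtain d where d: "d > 0" "\<And>x. d < norm (F - evaluation x)"
    using dist_range_evaluation_pos by blast
  obtain x :: "nat \<Rightarrow> 'a" where x: "range x \<subseteq> cball 0 1"
    "\<And>m u v. u \<in> convex hull (x ` {..<m}) \<Longrightarrow> v \<in> convex hull (x ` {m..}) \<Longrightarrow> d / 2 \<le> norm (u - v)"
    using james_sequence[OF \<open>norm F \<le> 1\<close> d] by blast
  have "d / 2 \<le> ca z" if z: "z \<in> cbs x" for z
    unfolding ca_def
  proof (rule cINF_greatest)
    fix n
    obtain k where k: "strict_mono k" "\<And>n. z n \<in> convex hull (x ` {k n..<k (Suc n)})"
      using z by (auto simp: cbs_def)
    \<comment> \<open>The cut is at \<open>k (Suc n)\<close>, where block \<open>n\<close> ends and
      block \<open>Suc n\<close> starts.\<close>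
    have "z n \<in> convex hull (x ` {..<k (Suc n)})"
      by (rule subsetD[OF hull_mono k(2)]) auto
    moreover have "z (Suc n) \<in> convex hull (x ` {k (Suc n)..})"
      by (rule subsetD[OF hull_mono k(2)]) auto
    ultimately have "d / 2 \<le> norm (z n - z (Suc n))" by (rule x(2))
    also have "\<dots> \<le> (SUP (k, l)\<in>{n..} \<times> {n..}. norm (z k - z l))"
    proof -
      have "bounded (range z)" using cbs_cball[OF x(1) z] bounded_cball bounded_subset by blast
      from cSUP_upper[OF _ ca_bdd_above[OF this], of "(n, Suc n)" n] show ?thesis by simp
    qed
    finally show "d / 2 \<le> (SUP (k, l)\<in>{n..} \<times> {n..}. norm (z k - z l))" .
  qed simp
  then have "d / 2 \<le> (INF z\<in>cbs x. ca z)"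
    using cbs_refl by (intro cINF_greatest) auto
  also have "\<dots> \<le> R_const TYPE('a)"
    unfolding R_const_def
    by (rule cSUP_upper) (use x(1) R_const_bounds(3) in \<open>auto simp: bdd_above_def\<close>)
  finally show ?thesis using d(1) by simp
qed

section \<open>Convex blocks in reflexive spaces\<close>

text \<open>A Hahn--Banach functional below \<open>f \<mapsto> limsup f (x n)\<close> is evaluation at a point lying in every
  closed convex hull of a tail.\<close>

lemma common_point_of_tail_hulls:
  fixes x :: "nat \<Rightarrow> 'a::real_normed_vector"
  assumes surj: "surj (evaluation :: 'a \<Rightarrow> _)" and x: "range x \<subseteq> cball 0 1"
  shows "\<exists>y. \<forall>n. \<forall>e>0. \<exists>c\<in>convex hull (x ` {n..}). norm (y - c) < e"
proof -
  \<comment> \<open>The eventual upper bounds of \<open>f (x n)\<close>; their infimum is the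
    limsup.\<close>
  define G where "G f = {c. eventually (\<lambda>n. blinfun_apply f (x n) \<le> c) sequentially}"
    for f :: "'a \<Rightarrow>\<^sub>L real"
  have xn: "norm (x n) \<le> 1" for n using x by (metis mem_cball_0 range_subsetD)
  \<comment> \<open>Besides nonemptiness, this later yields that \<open>F\<close> is
    bounded.\<close>
  have norm_G: "norm f \<in> G f" for f
    using blinfun_apply_le_norm[OF xn] by (auto simp: G_def)
  have bdd: "bdd_below (G f)" for f
  proof (rule bdd_belowI)
    fix c assume "c \<in> G f"
    then obtain n where "blinfun_apply f (x n) \<le> c"
      unfolding G_def by (auto simp: eventually_sequentially)
    moreover have "- blinfun_apply f (x n) \<le> norm f"
      using blinfun_apply_le_norm[OF xn, of "- f" n] by (simp add: blinfun.minus_left)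
    ultimately show "- norm f \<le> c" by simp
  qed
  have "sublinear (\<lambda>f. Inf (G f))"
  proof (rule sublinear_Inf)
    fix f g a b assume "a \<in> G f" "b \<in> G g"
    then have "a + b \<in> G (f + g)" unfolding G_def
      by (auto elim: eventually_elim2 simp: blinfun.add_left)
    then show "\<exists>c\<in>G (f + g). c \<le> a + b" by blast
  next
    fix f a and t :: real assume "a \<in> G f" "t > 0"
    then have "t * a \<in> G (t *\<^sub>R f)" unfolding G_def
      by (auto elim: eventually_mono simp: blinfun.scaleR_left)
    then show "\<exists>c\<in>G (t *\<^sub>R f). c \<le> t * a" by blast
  qed (use norm_G bdd in auto)
  then obtain F where F: "linear F" "\<And>f. F f \<le> Inf (G f)" using hahn_banach by blast
  have F_le: "F f \<le> c" if "c \<in> G f" for f c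
    using F(2)[of f] cInf_lower[OF that bdd] by simp
  have "norm (F f) \<le> 1 * norm f" for f
    using F_le[OF norm_G, of f] F_le[OF norm_G, of "- f"] linear_neg[OF F(1), of f]
    by (simp add: abs_le_iff)
  then have "bounded_linear F"
    using F(1) by (intro bounded_linear_intro[of _ 1]) (auto simp: linear_add linear_scale mult.commute)
  obtain y where "Blinfun F = evaluation y" using surj by blast
  then have y: "blinfun_apply f y \<le> c" if "c \<in> G f" for f c
    using F_le[OF that] bounded_linear_Blinfun_apply[OF \<open>bounded_linear F\<close>] by (metis evaluation_apply)
  have "\<exists>c\<in>convex hull (x ` {n..}). norm (y - c) < e" if "e > 0" for n e
  proof (rule ccontr)
    assume "\<not> ?thesis"
    then obtain f :: "'a \<Rightarrow>\<^sub>L real"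
      where f: "\<And>c. c \<in> convex hull (x ` {n..}) \<Longrightarrow> blinfun_apply f c + e \<le> blinfun_apply f y"
      using strict_separation_point_convex[of "convex hull (x ` {n..})" e y] by (auto simp: not_less)
    \<comment> \<open>Separation makes \<open>f y - e\<close> an eventual upper bound of
      \<open>f (x m)\<close>, but \<open>f y\<close> is below every such bound.\<close>
    have "blinfun_apply f (x m) \<le> blinfun_apply f y - e" if "m \<ge> n" for m
      using f[of "x m"] that by (simp add: hull_inc)
    then have "blinfun_apply f y - e \<in> G f"
      by (auto simp: G_def eventually_sequentially)
    then show False using y \<open>e > 0\<close> by fastforce
  qed
  then show ?thesis by blast
qed

text \<open>The hulls of finite segments increase, so their union is convex and contains the tail.
  The condition \<open>m > n\<close> later keeps block boundaries strictly increasing.\<close>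

lemma convex_hull_tail_finite:
  fixes x :: "nat \<Rightarrow> 'a::real_vector"
  assumes "c \<in> convex hull (x ` {n..})"
  shows "\<exists>m>n. c \<in> convex hull (x ` {n..<m})"
proof -
  have "convex (\<Union>m\<in>{n<..}. convex hull (x ` {n..<m}))"
  proof (rule convexI)
    fix a b and u v :: real
    assume ab: "a \<in> (\<Union>m\<in>{n<..}. convex hull (x ` {n..<m}))"
      "b \<in> (\<Union>m\<in>{n<..}. convex hull (x ` {n..<m}))"
      and uv: "0 \<le> u" "0 \<le> v" "u + v = 1"
    obtain i j where ij: "i > n" "a \<in> convex hull (x ` {n..<i})" "b \<in> convex hull (x ` {n..<j})"
      using ab by blast
    have "convex hull (x ` {n..<i}) \<subseteq> convex hull (x ` {n..<max i j})"
      "convex hull (x ` {n..<j}) \<subseteq> convex hull (x ` {n..<max i j})"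
      by (auto intro!: hull_mono)
    then have "u *\<^sub>R a + v *\<^sub>R b \<in> convex hull (x ` {n..<max i j})"
      using ij uv by (intro convexD) auto
    then show "u *\<^sub>R a + v *\<^sub>R b \<in> (\<Union>m\<in>{n<..}. convex hull (x ` {n..<m}))"
      using ij(1) by (intro UN_I[of "max i j"]) auto
  qed
  moreover have "x ` {n..} \<subseteq> (\<Union>m\<in>{n<..}. convex hull (x ` {n..<m}))"
  proof
    fix a assume "a \<in> x ` {n..}"
    then obtain i where "i \<ge> n" "a = x i" by auto
    then show "a \<in> (\<Union>m\<in>{n<..}. convex hull (x ` {n..<m}))"
      by (intro UN_I[of "Suc i"]) (auto simp: hull_inc)
  qed
  ultimately have "convex hull (x ` {n..}) \<subseteq> (\<Union>m\<in>{n<..}. convex hull (x ` {n..<m}))"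
    by (intro hull_minimal)
  then show ?thesis using assms by blast
qed

text \<open>Blocks chosen within \<open>e / 2\<close> of the common point are pairwise within
  \<open>e\<close>.\<close>

lemma R_const_eq_0_if_surj_evaluation:
  assumes "surj (evaluation :: 'a::banach \<Rightarrow> _)"
  shows "R_const TYPE('a) = 0"
proof -
  have "(INF z\<in>cbs x. ca z) = 0" if x: "range x \<subseteq> cball 0 1" for x :: "nat \<Rightarrow> 'a"
  proof (rule antisym)
    obtain y where y: "\<And>n e. e > 0 \<Longrightarrow> \<exists>c\<in>convex hull (x ` {n..}). norm (y - c) < e"
      using common_point_of_tail_hulls[OF assms x] by blast
    show "(INF z\<in>cbs x. ca z) \<le> 0"
    proof (rule field_le_epsilon)
      fix e :: real assume "e > 0"
      have "\<exists>m c. m > n \<and> c \<in> convex hull (x ` {n..<m}) \<and> norm (y - c) < e / 2" for n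
        using y[of "e / 2" n] \<open>e > 0\<close> convex_hull_tail_finite by (metis half_gt_zero)
      then obtain m c where mc: "\<And>n. m n > n" "\<And>n. c n \<in> convex hull (x ` {n..<m n})"
        "\<And>n. norm (y - c n) < e / 2" by metis
      \<comment> \<open>\<open>m\<close> sends the start of a block to its end, so its iterates at 0
        are the boundaries and \<open>c (k n)\<close> belongs to block \<open>n\<close>.\<close>
      define k where "k n = (m ^^ n) 0" for n
      have "strict_mono k" using mc(1) by (auto simp: strict_mono_Suc_iff k_def)
      then have z: "c \<circ> k \<in> cbs x"
        unfolding cbs_def using mc(2) by (auto simp: k_def intro!: exI[of _ k])
      have "norm (c i - c j) \<le> e" for i j
        using norm_triangle_ineq4[of "y - c j" "y - c i"] mc(3)[of i] mc(3)[of j] by simp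
      then have "(SUP (i, j)\<in>{0..} \<times> {0..}. norm ((c \<circ> k) i - (c \<circ> k) j)) \<le> e"
        by (intro cSUP_least) auto
      moreover have "ca (c \<circ> k) \<le> (SUP (i, j)\<in>{0..} \<times> {0..}. norm ((c \<circ> k) i - (c \<circ> k) j))"
      proof -
        have "bounded (range (c \<circ> k))" using cbs_cball[OF x z] bounded_cball bounded_subset by blast
        from ca_SUP_nonneg[OF this] show ?thesis
          unfolding ca_def by (intro cINF_lower bdd_belowI[of _ 0]) auto
      qed
      moreover have "(INF z\<in>cbs x. ca z) \<le> ca (c \<circ> k)"
        by (rule cINF_lower[OF R_const_bounds(1)[OF x] z])
      ultimately show "(INF z\<in>cbs x. ca z) \<le> 0 + e" by simp
    qed
  qed (rule R_const_bounds(2)[OF x])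
  \<comment> \<open>The supremum of a constant family is that constant only over a nonempty index
    set.\<close>
  moreover have "(\<lambda>_. 0) \<in> {x :: nat \<Rightarrow> 'a. range x \<subseteq> cball 0 1}" by auto
  ultimately have "(\<lambda>x. INF z\<in>cbs x. ca z) ` {x :: nat \<Rightarrow> 'a. range x \<subseteq> cball 0 1} =
      (\<lambda>_. 0) ` {x :: nat \<Rightarrow> 'a. range x \<subseteq> cball 0 1}"
    by (intro image_cong) auto
  also have "\<dots> = {0}" using \<open>(\<lambda>_. 0) \<in> _\<close> by blast
  finally show ?thesis unfolding R_const_def by simp
qed

lemma surj_evaluation_iff_R_const:
  "surj (evaluation :: 'a::banach \<Rightarrow> _) \<longleftrightarrow> R_const TYPE('a) = 0"
  using R_const_eq_0_if_surj_evaluation R_const_pos_if_not_surj_evaluation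
  by (metis less_irrefl)

section \<open>Reduction to the canonical embedding of the real dual\<close>

text \<open>One inclusion always holds, and extensionality reduces the other to agreement on the
  dual.\<close>

lemma reflexive_iff_bidual_subset:
  assumes "normed_space_over sm"
  shows "reflexive sm \<longleftrightarrow> (\<forall>\<phi>\<in>bidual sm. \<exists>x. \<forall>f\<in>dual sm. \<phi> f = f x)"
proof
  assume "reflexive sm"
  then show "\<forall>\<phi>\<in>bidual sm. \<exists>x. \<forall>f\<in>dual sm. \<phi> f = f x"
    unfolding reflexive_def canonical_embedding_def by (metis (no_types, lifting) imageE restrict_apply')
next
  assume R: "\<forall>\<phi>\<in>bidual sm. \<exists>x. \<forall>f\<in>dual sm. \<phi> f = f x"
  have "\<phi> \<in> range (canonical_embedding sm)" if \<phi>: "\<phi> \<in> bidual sm" for \<phi>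
  proof -
    obtain x where "\<forall>f\<in>dual sm. \<phi> f = f x" using R \<phi> by blast
    moreover have "\<phi> \<in> extensional (dual sm)" using \<phi> by (simp add: bidual_def)
    ultimately have "\<phi> = canonical_embedding sm x"
      unfolding canonical_embedding_def by (intro extensionalityI[of _ "dual sm"]) auto
    then show ?thesis by blast
  qed
  then show "reflexive sm"
    unfolding reflexive_def using canonical_embedding_in_bidual[OF assms] by blast
qed

section \<open>Transfer between sets of functionals and types of bounded linear maps\<close>

lemma Blinfun_add:
  "bounded_linear f \<Longrightarrow> bounded_linear g \<Longrightarrow> Blinfun (\<lambda>x. f x + g x) = Blinfun f + Blinfun g"
  by (rule blinfun_eqI) (simp add: bounded_linear_Blinfun_apply bounded_linear_add blinfun.add_left)

lemma Blinfun_mult: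
  fixes f :: "'a::real_normed_vector \<Rightarrow> real"
  shows "bounded_linear f \<Longrightarrow> Blinfun (\<lambda>x. c * f x) = c *\<^sub>R Blinfun f"
  by (rule blinfun_eqI)
    (simp add: bounded_linear_Blinfun_apply bounded_linear_const_mult blinfun.scaleR_left)

lemma norm_Blinfun: "bounded_linear f \<Longrightarrow> norm (Blinfun f) = onorm f"
  by (simp add: norm_blinfun.rep_eq bounded_linear_Blinfun_apply)

lemma bounded_linear_blinfunI:
  fixes \<psi> :: "('a::real_normed_vector \<Rightarrow>\<^sub>L real) \<Rightarrow> real"
  assumes "\<And>f g. \<psi> (f + g) = \<psi> f + \<psi> g" "\<And>c f. \<psi> (c *\<^sub>R f) = c * \<psi> f" "\<And>f. norm (\<psi> f) \<le> C * norm f"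
  shows "bounded_linear \<psi>"
  using assms by (intro bounded_linear_intro[of _ C]) (auto simp: mult.commute)

lemma real_dual_eq: "dual (scaleR :: real \<Rightarrow> 'a::real_normed_vector \<Rightarrow> 'a) = Collect bounded_linear"
  by (auto simp: dual_def linear_simps)

lemma reflexive_real_iff_surj_evaluation:
  "reflexive (scaleR :: real \<Rightarrow> 'a::real_normed_vector \<Rightarrow> 'a) \<longleftrightarrow> surj (evaluation :: 'a \<Rightarrow> _)"
proof
  assume R: "reflexive (scaleR :: real \<Rightarrow> 'a \<Rightarrow> 'a)"
  have "F \<in> range evaluation" for F :: "('a \<Rightarrow>\<^sub>L real) \<Rightarrow>\<^sub>L real"
  proof -
    define \<phi> where "\<phi> = (\<lambda>f\<in>dual (scaleR :: real \<Rightarrow> 'a \<Rightarrow> 'a). blinfun_apply F (Blinfun f))"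
    have "norm (\<phi> f) \<le> norm F * onorm f" if "bounded_linear f" for f
      using norm_blinfun[of F "Blinfun f"] that by (simp add: \<phi>_def real_dual_eq norm_Blinfun)
    then have "\<phi> \<in> bidual scaleR"
      by (auto simp: bidual_def \<phi>_def real_dual_eq Blinfun_add Blinfun_mult bounded_linear_add
        bounded_linear_const_mult blinfun.add_right blinfun.scaleR_right)
    then obtain x where x: "\<And>f. bounded_linear f \<Longrightarrow> \<phi> f = f x"
      using R by (auto simp: reflexive_iff_bidual_subset[OF normed_space_over_scaleR] real_dual_eq)
    have "F = evaluation x"
      using x[OF bounded_linear_blinfun_apply[OF bounded_linear_ident]]
      by (intro blinfun_eqI)
        (simp add: \<phi>_def real_dual_eq blinfun_apply_inverse bounded_linear_blinfun_apply[OF bounded_linear_ident])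
    then show ?thesis by blast
  qed
  then show "surj (evaluation :: 'a \<Rightarrow> _)" by blast
next
  assume S: "surj (evaluation :: 'a \<Rightarrow> _)"
  show "reflexive (scaleR :: real \<Rightarrow> 'a \<Rightarrow> 'a)"
    unfolding reflexive_iff_bidual_subset[OF normed_space_over_scaleR]
  proof
    fix \<phi> assume \<phi>: "\<phi> \<in> bidual (scaleR :: real \<Rightarrow> 'a \<Rightarrow> 'a)"
    obtain C where C: "\<And>f. bounded_linear f \<Longrightarrow> norm (\<phi> f) \<le> C * onorm f"
      using \<phi> by (auto simp: bidual_def real_dual_eq)
    define F where "F f = \<phi> (blinfun_apply f)" for f :: "'a \<Rightarrow>\<^sub>L real"
    have bl: "bounded_linear (blinfun_apply f)" for f :: "'a \<Rightarrow>\<^sub>L real"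
      by (rule bounded_linear_blinfun_apply[OF bounded_linear_ident])
    have "bounded_linear F"
    proof (rule bounded_linear_blinfunI)
      show "F (f + g) = F f + F g" for f g
        using \<phi> bl[of f] bl[of g] by (simp add: F_def bidual_def real_dual_eq plus_blinfun.rep_eq)
      show "F (c *\<^sub>R f) = c * F f" for c f
        using \<phi> bl[of f] by (simp add: F_def bidual_def real_dual_eq scaleR_blinfun.rep_eq)
      show "norm (F f) \<le> C * norm f" for f
        using C[OF bl[of f]] by (simp add: F_def norm_blinfun.rep_eq)
    qed
    moreover obtain x where "Blinfun F = evaluation x" using S by blast
    ultimately have F: "F f = blinfun_apply f x" for f
      by (metis bounded_linear_Blinfun_apply evaluation_apply)
    have "\<phi> f = f x" if "bounded_linear f" for f
      using F[of "Blinfun f"] that by (simp add: F_def bounded_linear_Blinfun_apply)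
    then show "\<exists>x. \<forall>f\<in>dual scaleR. \<phi> f = f x" by (auto simp: real_dual_eq)
  qed
qed

text \<open>A complex functional and its real part determine each other through
  \<open>f x = Re (f x) - \<i> Re (f (\<i> x))\<close>.\<close>

definition complexify :: "(complex \<Rightarrow> 'a \<Rightarrow> 'a) \<Rightarrow> ('a::real_normed_vector \<Rightarrow>\<^sub>L real) \<Rightarrow> 'a \<Rightarrow> complex" where
  "complexify sm g x = Complex (blinfun_apply g x) (- blinfun_apply g (sm \<i> x))"

section \<open>Complex scalars\<close>

context
  fixes sm :: "complex \<Rightarrow> 'a::real_normed_vector \<Rightarrow> 'a"
  assumes sm: "normed_space_over sm"
begin

interpretation normed_space_over sm by (rule sm)

lemma sm_Complex: "sm (Complex a b) x = a *\<^sub>R x + b *\<^sub>R sm \<i> x"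
proof -
  have "Complex a b = of_real a + of_real b * \<i>" by (simp add: complex_eq_iff)
  then show ?thesis by (simp add: scale_left_distrib scale_of_real flip: scale_scale)
qed

lemma bounded_linear_sm: "bounded_linear (sm c)"
  by (rule bounded_linear_intro[of _ "norm c"])
    (auto simp: scale_right_distrib norm_scale mult.commute simp flip: scale_of_real)

lemma complexify_in_dual: "complexify sm g \<in> dual sm"
proof -
  have g: "blinfun_apply g (sm (Complex a b) x) = a * blinfun_apply g x + b * blinfun_apply g (sm \<i> x)" for a b x
    by (simp add: sm_Complex blinfun.add_right blinfun.scaleR_right)
  have "complexify sm g (sm c x) = c * complexify sm g x" for c x
  proof (cases c)
    case (Complex a b)
    \<comment> \<open>Thus both components at \<open>sm c x\<close> expand in \<open>g x\<close> and
      \<open>g (sm \<i> x)\<close>, as the complex product does.\<close>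
    have "\<i> * c = Complex (- b) a" by (simp add: Complex complex_eq_iff)
    then have i: "sm \<i> (sm c x) = sm (Complex (- b) a) x" by simp
    show ?thesis unfolding complexify_def i g by (simp add: Complex g complex_eq_iff)
  qed
  moreover have "complexify sm g =
      (\<lambda>x. of_real (blinfun_apply g x) - \<i> * of_real (blinfun_apply g (sm \<i> x)))"
    by (simp add: complexify_def fun_eq_iff complex_eq_iff)
  then have "bounded_linear (complexify sm g)"
    by (simp only:) (intro bounded_linear_sub bounded_linear_const_mult
      bounded_linear_compose[OF bounded_linear_of_real] bounded_linear_blinfun_apply bounded_linear_sm
      bounded_linear_ident)
  ultimately show ?thesis by (simp add: dual_def)
qed

lemma onorm_complexify_le: "onorm (complexify sm g) \<le> 2 * norm g"
proof (rule onorm_bound)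
  fix x
  have "norm (complexify sm g x) \<le> \<bar>blinfun_apply g x\<bar> + \<bar>blinfun_apply g (sm \<i> x)\<bar>"
    using cmod_le[of "complexify sm g x"] by (simp add: complexify_def)
  also have "\<dots> \<le> norm g * norm x + norm g * norm x"
    using norm_blinfun[of g x] norm_blinfun[of g "sm \<i> x"] by (intro add_mono) (auto simp: norm_scale)
  finally show "norm (complexify sm g x) \<le> 2 * norm g * norm x" by (simp add: mult_ac)
qed simp

lemma complexify_Re:
  assumes "f \<in> dual sm"
  shows "complexify sm (Blinfun (\<lambda>x. Re (f x))) = f"
proof -
  have "bounded_linear (\<lambda>x. Re (f x))"
    using assms by (auto simp: dual_def intro: bounded_linear_compose[OF bounded_linear_Re])
  moreover have "f (sm \<i> x) = \<i> * f x" for x using assms by (simp add: dual_def)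
  ultimately show ?thesis
    by (auto simp: complexify_def bounded_linear_Blinfun_apply complex_eq_iff)
qed

text \<open>The real part of \<open>\<phi>\<close> along \<open>complexify\<close> is a bounded
  functional on the real dual, hence evaluation at some \<open>x\<close>. This settles real parts;
  passing to \<open>\<i> * f\<close> settles imaginary parts.\<close>

lemma reflexive_if_surj_evaluation:
  assumes S: "surj (evaluation :: 'a \<Rightarrow> _)"
  shows "reflexive sm"
  unfolding reflexive_iff_bidual_subset[OF sm]
proof
  fix \<phi> assume \<phi>: "\<phi> \<in> bidual sm"
  have \<phi>_mult: "\<phi> (\<lambda>x. c * f x) = c * \<phi> f" if "f \<in> dual sm" for c f
    using \<phi> that by (simp add: bidual_def)
  obtain C where C: "\<And>f. f \<in> dual sm \<Longrightarrow> norm (\<phi> f) \<le> C * onorm f"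
    using \<phi> unfolding bidual_def by blast
  define F where "F g = Re (\<phi> (complexify sm g))" for g
  have "bounded_linear F"
  proof (rule bounded_linear_blinfunI)
    fix f g
    have "complexify sm (f + g) = (\<lambda>x. complexify sm f x + complexify sm g x)"
      by (simp add: complexify_def blinfun.add_left fun_eq_iff complex_eq_iff)
    then show "F (f + g) = F f + F g"
      using \<phi> complexify_in_dual by (simp add: F_def bidual_def)
  next
    fix c f
    have "complexify sm (c *\<^sub>R f) = (\<lambda>x. of_real c * complexify sm f x)"
      by (simp add: complexify_def blinfun.scaleR_left fun_eq_iff complex_eq_iff)
    then show "F (c *\<^sub>R f) = c * F f"
      using \<phi>_mult[OF complexify_in_dual] by (simp add: F_def)
  next
    fix g
    have "\<bar>F g\<bar> \<le> norm (\<phi> (complexify sm g))" by (simp add: F_def abs_Re_le_cmod)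
    \<comment> \<open>The sign of \<open>C\<close> is unknown; \<open>\<bar>C\<bar>\<close> allows
      the bound on \<open>onorm\<close> to be multiplied through.\<close>
    also have "\<dots> \<le> \<bar>C\<bar> * onorm (complexify sm g)"
    proof -
      have "0 \<le> onorm (complexify sm g)"
        using complexify_in_dual[of g] by (intro onorm_pos_le) (simp add: dual_def)
      then have "C * onorm (complexify sm g) \<le> \<bar>C\<bar> * onorm (complexify sm g)"
        by (intro mult_right_mono) simp_all
      then show ?thesis using C[OF complexify_in_dual, of g] by linarith
    qed
    also have "\<dots> \<le> \<bar>C\<bar> * (2 * norm g)" by (intro mult_left_mono onorm_complexify_le) auto
    finally show "norm (F g) \<le> (2 * \<bar>C\<bar>) * norm g" by simp
  qed
  moreover obtain x where "Blinfun F = evaluation x" using S by blast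
  ultimately have F: "F f = blinfun_apply f x" for f
    by (metis bounded_linear_Blinfun_apply evaluation_apply)
  have Re: "Re (\<phi> f) = Re (f x)" if "f \<in> dual sm" for f
  proof -
    have "bounded_linear (\<lambda>x. Re (f x))"
      using that by (auto simp: dual_def intro: bounded_linear_compose[OF bounded_linear_Re])
    then show ?thesis
      using F[of "Blinfun (\<lambda>x. Re (f x))"] complexify_Re[OF that]
      by (simp add: F_def bounded_linear_Blinfun_apply)
  qed
  have "\<phi> f = f x" if f: "f \<in> dual sm" for f
  proof -
    have "(\<lambda>x. \<i> * f x) \<in> dual sm"
      using f by (auto simp: dual_def intro: bounded_linear_const_mult)
    from Re[OF this] have "Im (\<phi> f) = Im (f x)" using \<phi>_mult[OF f] by simp
    then show ?thesis using Re[OF f] by (simp add: complex_eq_iff)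
  qed
  then show "\<exists>x. \<forall>f\<in>dual sm. \<phi> f = f x" by blast
qed

lemma surj_evaluation_if_reflexive:
  assumes "reflexive sm"
  shows "surj (evaluation :: 'a \<Rightarrow> _)"
proof -
  have "F \<in> range evaluation" for F :: "('a \<Rightarrow>\<^sub>L real) \<Rightarrow>\<^sub>L real"
  proof -
    \<comment> \<open>Applying \<open>F\<close> to real and imaginary parts separately gives a
      complex-linear functional on the dual.\<close>
    define \<psi> where "\<psi> f = Complex (blinfun_apply F (Blinfun (\<lambda>x. Re (f x))))
       (blinfun_apply F (Blinfun (\<lambda>x. Im (f x))))" for f :: "'a \<Rightarrow> complex"
    have blRe: "bounded_linear (\<lambda>x. Re (f x))" and blIm: "bounded_linear (\<lambda>x. Im (f x))"
      if "f \<in> dual sm" for f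
      using that by (auto simp: dual_def intro: bounded_linear_compose[OF bounded_linear_Re]
        bounded_linear_compose[OF bounded_linear_Im])
    have add: "\<psi> (\<lambda>x. f x + g x) = \<psi> f + \<psi> g" if "f \<in> dual sm" "g \<in> dual sm" for f g
      using blRe[OF that(1)] blIm[OF that(1)] blRe[OF that(2)] blIm[OF that(2)]
      by (simp add: \<psi>_def Blinfun_add blinfun.add_right complex_eq_iff)
    have mult: "\<psi> (\<lambda>x. c * f x) = c * \<psi> f" if "f \<in> dual sm" for c f
    proof -
      note bl = blRe[OF that] blIm[OF that]
      have "Blinfun (\<lambda>x. Re (c * f x)) =
          Re c *\<^sub>R Blinfun (\<lambda>x. Re (f x)) - Im c *\<^sub>R Blinfun (\<lambda>x. Im (f x))"
        "Blinfun (\<lambda>x. Im (c * f x)) =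
          Re c *\<^sub>R Blinfun (\<lambda>x. Im (f x)) + Im c *\<^sub>R Blinfun (\<lambda>x. Re (f x))"
        using bl by (auto intro!: blinfun_eqI simp: bounded_linear_Blinfun_apply blinfun.add_left
          blinfun.diff_left blinfun.scaleR_left bounded_linear_add bounded_linear_sub bounded_linear_const_mult)
      then show ?thesis
        by (simp add: \<psi>_def complex_eq_iff blinfun.add_right blinfun.diff_right blinfun.scaleR_right)
    qed
    have bound: "norm (\<psi> f) \<le> 2 * norm F * onorm f" if "f \<in> dual sm" for f
    proof -
      note bl = blRe[OF that] blIm[OF that]
      have f: "bounded_linear f" using that by (simp add: dual_def)
      have "onorm (\<lambda>x. Re (f x)) \<le> onorm f" "onorm (\<lambda>x. Im (f x)) \<le> onorm f"
        by (intro onorm_bound onorm_pos_le f; unfold real_norm_def,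
            rule order_trans[OF abs_Re_le_cmod onorm[OF f]] order_trans[OF abs_Im_le_cmod onorm[OF f]])+
      then have "norm F * norm (Blinfun (\<lambda>x. Re (f x))) \<le> norm F * onorm f"
        "norm F * norm (Blinfun (\<lambda>x. Im (f x))) \<le> norm F * onorm f"
        using bl by (auto simp: norm_Blinfun intro!: mult_left_mono)
      moreover have "norm (\<psi> f) \<le> \<bar>Re (\<psi> f)\<bar> + \<bar>Im (\<psi> f)\<bar>" by (rule cmod_le)
      ultimately show ?thesis
        using norm_blinfun[of F "Blinfun (\<lambda>x. Re (f x))"] norm_blinfun[of F "Blinfun (\<lambda>x. Im (f x))"]
        by (simp add: \<psi>_def)
    qed
    have "(\<lambda>x. f x + g x) \<in> dual sm" if "f \<in> dual sm" "g \<in> dual sm" for f g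
      using that by (auto simp: dual_def algebra_simps intro: bounded_linear_add)
    moreover have "(\<lambda>x. c * f x) \<in> dual sm" if "f \<in> dual sm" for f c
      using that by (auto simp: dual_def intro: bounded_linear_const_mult)
    ultimately have "restrict \<psi> (dual sm) \<in> bidual sm"
      using add mult bound by (auto simp: bidual_def intro!: exI[of _ "2 * norm F"])
    then obtain x where x: "\<And>f. f \<in> dual sm \<Longrightarrow> \<psi> f = f x"
      using assms by (auto simp: reflexive_iff_bidual_subset[OF sm])
    have "blinfun_apply F g = blinfun_apply g x" for g
    proof -
      \<comment> \<open>Every real functional is the real part of a member of the dual, so real
        parts recover \<open>F\<close>.\<close>
      have "Blinfun (\<lambda>x. Re (complexify sm g x)) = g"
        by (simp add: complexify_def blinfun_apply_inverse)
      then show ?thesis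
        using arg_cong[OF x[OF complexify_in_dual[of g]], of Re] by (simp add: \<psi>_def complexify_def)
    qed
    then have "F = evaluation x" by (intro blinfun_eqI) simp
    then show ?thesis by blast
  qed
  then show ?thesis by blast
qed

end

text \<open>\<open>R_const\<close> sees only the norm and real convexity, so for both fields the
  equivalence passes through surjectivity of the real \<open>evaluation\<close>.\<close>

theorem theorem4p7:
  shows "(infinite_dimensional (scaleR :: real \<Rightarrow> 'a::banach \<Rightarrow> 'a) \<longrightarrow>
            (reflexive (scaleR :: real \<Rightarrow> 'a \<Rightarrow> 'a) \<longleftrightarrow> R_const TYPE('a) = 0)) \<and>
         (\<forall>scaleC :: complex \<Rightarrow> 'a \<Rightarrow> 'a.
            normed_space_over scaleC \<longrightarrow> infinite_dimensional scaleC \<longrightarrow>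
            (reflexive scaleC \<longleftrightarrow> R_const TYPE('a) = 0))"
  using reflexive_real_iff_surj_evaluation[where 'a = 'a] surj_evaluation_iff_R_const[where 'a = 'a]
    reflexive_if_surj_evaluation surj_evaluation_if_reflexive by blast

end
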